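(* Let $\mathcal{X}\subseteq\mathbb{R}^n$, let $H(\mathbf{x},\boldsymbol{\xi})$ be a loss function, let $(\Omega_1,\Sigma_1,\mathbb{P}_1)$ be a probability space whose elements $F$ are probability distributions of $\boldsymbol{\xi}\in\mathbb{R}^s$, and let $\delta\in(0,1)$. Let $\mathbf{x}^*_{\mathrm{VaR}}$ and $\gamma^*_{\mathrm{VaR}}$ be an optimal solution and the (finite) optimal value of the VaR-Expectation problem $$\min_{\mathbf{x}\in\mathcal{X}}\ \mathrm{VaR}_\delta\big(\mathbb{E}_{\boldsymbol{\xi}\sim F}[H(\mathbf{x},\boldsymbol{\xi})]\big),$$ and let $\hat{\mathcal{F}}^*=\{F\in\Omega_1:\mathbb{E}_{\boldsymbol{\xi}\sim F}[H(\mathbf{x}^*_{\mathrm{VaR}},\boldsymbol{\xi})]\leq\gamma^*_{\mathrm{VaR}}\}$. Then $(\mathbf{x}^*_{\mathrm{VaR}},\hat{\mathcal{F}}^* )$ is an optimal solution of $$\min_{\mathbf{x}\in\mathcal{X},\ \mathcal{F}\in\Sigma_1}\ \sup_{F\in\mathcal{F}}\mathbb{E}_{\boldsymbol{\xi}\sim F}[H(\mathbf{x},\boldsymbol{\xi})]\quad\text{s.t.}\quad \mathbb{P}_1(F\notin\mathcal{F})\leq 1-\delta .$$ Moreover, let $\mathcal{F}_{\mathrm{DR}}\in\Sigma_1$ be a distribution set (not depending on $\mathbf{x}$) with the same robustness level, i.e. $\mathbb{P}_1(F\notin\mathcal{F}_{\mathrm{DR}})\leq 1-\delta$, and let $\mathbf{x}^*_{\mathrm{DR}}$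 and $\gamma^*_{\mathrm{DR}}$ be an optimal solution and the optimal value of the distributionally robust problem $$\min_{\mathbf{x}\in\mathcal{X}}\ \sup_{F\in\mathcal{F}_{\mathrm{DR}}}\mathbb{E}_{\boldsymbol{\xi}\sim F}[H(\mathbf{x},\boldsymbol{\xi})].$$ Then $(\mathbf{x}^*_{\mathrm{DR}},\mathcal{F}_{\mathrm{DR}})$ is a feasible solution of the problem over pairs $(\mathbf{x},\mathcal{F})$ above, and $\gamma^*_{\mathrm{VaR}}\leq\gamma^*_{\mathrm{DR}}$.
   Context: For each $\mathbf{x}\in\mathcal{X}$, $F\mapsto\mathbb{E}_{\boldsymbol{\xi}\sim F}[H(\mathbf{x},\boldsymbol{\xi})]$ (the expectation of $H(\mathbf{x},\boldsymbol{\xi})$ when $\boldsymbol{\xi}$ has distribution $F$) is regarded as a real-valued random variable on $(\Omega_1,\Sigma_1,\mathbb{P}_1)$; it is assumed finite and measurable. For a real random variable $Z$ on $\Omega_1$, the $\delta$-Value-at-Risk is $$\mathrm{VaR}_\delta(Z)=\inf\{t\in\mathbb{R}:\ \mathbb{P}_1(Z\geq t)\leq 1-\delta\}.$$ *)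

theory Defs
  imports "HOL-Probability.Probability"
begin

(* If Z is a real random variable and 0 < delta < 1, the set below is nonempty and bounded
   below, so the infimum over the reals is the genuine one. *)
definition VaR :: "'a measure \<Rightarrow> real \<Rightarrow> ('a \<Rightarrow> real) \<Rightarrow> real" where
  "VaR M \<delta> Z = Inf {t. \<P>(\<omega> in M. Z \<omega> \<ge> t) \<le> 1 - \<delta>}"

definition expected_loss :: "('x \<Rightarrow> 'b \<Rightarrow> real) \<Rightarrow> 'x \<Rightarrow> 'b measure \<Rightarrow> real" where
  "expected_loss H x F = (\<integral>\<xi>. H x \<xi> \<partial>F)"

(* Extended-real valued: the supremum over a distribution set may be infinite.
   Over the empty set it is minus infinity. *)
definition worst_case_loss :: "('x \<Rightarrow> 'b \<Rightarrow> real) \<Rightarrow> 'x \<Rightarrow> 'b measure set \<Rightarrow> ereal" where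
  "worst_case_loss H x \<F> = (SUP F\<in>\<F>. ereal (expected_loss H x F))"

definition robust_feasible ::
  "'x set \<Rightarrow> 'b measure measure \<Rightarrow> real \<Rightarrow> 'x \<times> 'b measure set \<Rightarrow> bool" where
  "robust_feasible X P \<delta> = (\<lambda>(x, \<F>). x \<in> X \<and> \<F> \<in> sets P \<and> \<P>(F in P. F \<notin> \<F>) \<le> 1 - \<delta>)"

end

theory Submission
  imports Defs
begin

text \<open>
  The infimum defining \<open>VaR\<close> turns into two facts about \<open>v = VaR M \<delta> Z\<close>. By continuity of
  the probability measure along \<open>{Z \<ge> v + 1/n} \<up> {Z > v}\<close> we have \<open>P(Z > v) \<le> 1 - \<delta>\<close>, so the
  sublevel set of the VaR-optimal loss is feasible. Conversely, if an event of probability at least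
  \<open>\<delta>\<close> bounds \<open>Z\<close> by some number strictly below \<open>t\<close>, then \<open>P(Z \<ge> t) \<le> 1 - \<delta>\<close>, so \<open>v \<le> t\<close>; hence no
  feasible distribution set has a worst-case loss below the VaR.
\<close>

text \<open>The events \<open>Z \<ge> n\<close> decrease to the empty set, so their probabilities
  tend to 0 and eventually fall below \<open>1 - \<delta>\<close>. Together with the bound from
  below, this makes the real \<open>Inf\<close> in \<open>VaR\<close> a genuine infimum.\<close>

lemma (in prob_space) VaR_levels_nonempty:
  fixes Z :: "'a \<Rightarrow> real"
  assumes [measurable]: "Z \<in> borel_measurable M" and "\<delta> < 1"
  shows "{t. \<P>(\<omega> in M. Z \<omega> \<ge> t) \<le> 1 - \<delta>} \<noteq> {}"
proof -
  let ?A = "\<lambda>n::nat. {\<omega> \<in> space M. Z \<omega> \<ge> real n}"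
  have "(\<Inter>n. ?A n) = {}"
  proof -
    have "\<exists>n. \<not> real n \<le> Z \<omega>" for \<omega>
      using reals_Archimedean2[of "Z \<omega>"] by (auto simp: not_le)
    then show ?thesis by auto
  qed
  moreover have "decseq ?A" by (auto simp: decseq_def)
  ultimately have "(\<lambda>n. prob (?A n)) \<longlonglongrightarrow> 0"
    using finite_Lim_measure_decseq[of ?A] by (simp add: image_subset_iff)
  then have "\<forall>\<^sub>F n in sequentially. prob (?A n) < 1 - \<delta>"
    using \<open>\<delta> < 1\<close> by (intro order_tendstoD(2)) auto
  then obtain n where "prob (?A n) < 1 - \<delta>"
    by (auto simp: eventually_sequentially)
  then show ?thesis by (auto intro: less_imp_le)
qed

text \<open>Dually, the events \<open>Z \<ge> - n\<close> increase to the whole space, so some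
  \<open>- n\<close> is violated with too large a probability; any level below it has a still larger
  event.\<close>

lemma (in prob_space) bdd_below_VaR_levels:
  fixes Z :: "'a \<Rightarrow> real"
  assumes [measurable]: "Z \<in> borel_measurable M" and "0 < \<delta>"
  shows "bdd_below {t. \<P>(\<omega> in M. Z \<omega> \<ge> t) \<le> 1 - \<delta>}"
proof -
  let ?A = "\<lambda>n::nat. {\<omega> \<in> space M. Z \<omega> \<ge> - real n}"
  have "(\<Union>n. ?A n) = space M"
  proof -
    have "\<exists>n. - real n \<le> Z \<omega>" for \<omega>
      using real_arch_simple[of "- Z \<omega>"] by (auto simp: minus_le_iff)
    then show ?thesis by auto
  qed
  moreover have "incseq ?A" by (auto simp: incseq_def)
  ultimately have "(\<lambda>n. prob (?A n)) \<longlonglongrightarrow> 1"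
    using finite_Lim_measure_incseq[of ?A] by (simp add: image_subset_iff prob_space)
  then have "\<forall>\<^sub>F n in sequentially. 1 - \<delta> < prob (?A n)"
    using \<open>0 < \<delta>\<close> by (intro order_tendstoD(1)) auto
  then obtain n where n: "1 - \<delta> < prob (?A n)"
    by (auto simp: eventually_sequentially)
  have "- real n \<le> t" if t: "\<P>(\<omega> in M. Z \<omega> \<ge> t) \<le> 1 - \<delta>" for t
  proof (rule ccontr)
    assume "\<not> - real n \<le> t"
    then have "prob (?A n) \<le> \<P>(\<omega> in M. Z \<omega> \<ge> t)"
      by (intro finite_measure_mono) auto
    with n t show False by simp
  qed
  then show ?thesis by (auto simp: bdd_below_def)
qed

text \<open>Allowing any \<open>v\<close> from the VaR upwards lets the bound be applied at
  \<open>\<gamma>_VaR\<close> knowing only one inequality.\<close>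

lemma (in prob_space) prob_greater_VaR_le:
  fixes Z :: "'a \<Rightarrow> real"
  assumes [measurable]: "Z \<in> borel_measurable M" and "\<delta> < 1" and v: "VaR M \<delta> Z \<le> v"
  shows "\<P>(\<omega> in M. Z \<omega> > v) \<le> 1 - \<delta>"
proof -
  \<comment> \<open>\<open>Suc n\<close> keeps the offset positive: at \<open>n = 0\<close> the
    value \<open>1 / 0 = 0\<close> would let points with \<open>Z \<omega> = v\<close> into the
    union.\<close>
  let ?A = "\<lambda>n::nat. {\<omega> \<in> space M. Z \<omega> \<ge> v + 1 / real (Suc n)}"
  have "(\<Union>n. ?A n) = {\<omega> \<in> space M. Z \<omega> > v}"
  proof (intro set_eqI iffI)
    fix \<omega> assume "\<omega> \<in> (\<Union>n. ?A n)"
    then obtain n where "\<omega> \<in> space M" "v + 1 / real (Suc n) \<le> Z \<omega>" by auto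
    moreover have "v < v + 1 / real (Suc n)" by simp
    ultimately have "v < Z \<omega>" by linarith
    then show "\<omega> \<in> {\<omega> \<in> space M. Z \<omega> > v}" using \<open>\<omega> \<in> space M\<close> by simp
  next
    fix \<omega> assume \<omega>: "\<omega> \<in> {\<omega> \<in> space M. Z \<omega> > v}"
    then obtain n where "1 / real (Suc n) < Z \<omega> - v"
      using nat_approx_posE[of "Z \<omega> - v"] by auto
    then have "\<omega> \<in> ?A n" using \<omega> by (simp del: of_nat_Suc)
    then show "\<omega> \<in> (\<Union>n. ?A n)" by blast
  qed
  moreover have "incseq ?A"
  proof (rule incseq_SucI)
    fix n
    have "1 / real (Suc (Suc n)) \<le> 1 / real (Suc n)" by (simp add: frac_le)
    then show "?A n \<le> ?A (Suc n)" by (auto simp del: of_nat_Suc)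
  qed
  ultimately have lim: "(\<lambda>n. prob (?A n)) \<longlonglongrightarrow> \<P>(\<omega> in M. Z \<omega> > v)"
    using finite_Lim_measure_incseq[of ?A] by (simp add: image_subset_iff)
  have "prob (?A n) \<le> 1 - \<delta>" for n
  proof -
    \<comment> \<open>The infimum need not be an admissible level itself, but the strict gap yields
      an admissible \<open>t\<close> below the threshold, whose event contains
      \<open>?A n\<close>.\<close>
    have "Inf {t. \<P>(\<omega> in M. Z \<omega> \<ge> t) \<le> 1 - \<delta>} < v + 1 / real (Suc n)"
      using v by (auto simp: VaR_def intro: le_less_trans)
    then obtain t where "\<P>(\<omega> in M. Z \<omega> \<ge> t) \<le> 1 - \<delta>" "t < v + 1 / real (Suc n)"
      using cInf_lessD[OF VaR_levels_nonempty[OF assms(1,2)]] by blast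
    moreover from this have "prob (?A n) \<le> \<P>(\<omega> in M. Z \<omega> \<ge> t)"
      by (intro finite_measure_mono) auto
    ultimately show ?thesis by simp
  qed
  then show ?thesis using lim by (intro LIMSEQ_le_const2) auto
qed

lemma VaR_le_worst_case_loss:
  assumes "prob_space P" and meas: "expected_loss H x \<in> borel_measurable P" and "0 < \<delta>"
    and "\<F> \<in> sets P" and feas: "\<P>(F in P. F \<notin> \<F>) \<le> 1 - \<delta>"
  shows "ereal (VaR P \<delta> (expected_loss H x)) \<le> worst_case_loss H x \<F>"
proof (rule ccontr)
  interpret prob_space P by fact
  assume "\<not> ?thesis"
  \<comment> \<open>A real \<open>t\<close> strictly in between also covers a worst-case loss of
    minus infinity. Strictness on the left keeps all of \<open>\<F>\<close> out of the event
    \<open>expected_loss H x F \<ge> t\<close>.\<close>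
  then obtain t where t: "worst_case_loss H x \<F> < ereal t" "t < VaR P \<delta> (expected_loss H x)"
    using ereal_dense2 by (metis not_le less_ereal.simps(1))
  have "expected_loss H x F < t" if "F \<in> \<F>" for F
  proof -
    have "ereal (expected_loss H x F) \<le> worst_case_loss H x \<F>"
      unfolding worst_case_loss_def using that by (rule SUP_upper)
    also have "\<dots> < ereal t" by (rule t)
    finally show ?thesis by simp
  qed
  then have "{F \<in> space P. expected_loss H x F \<ge> t} \<subseteq> {F \<in> space P. F \<notin> \<F>}"
    by (auto simp: not_le[symmetric])
  moreover have "{F \<in> space P. F \<notin> \<F>} = space P - \<F>" by auto
  then have "{F \<in> space P. F \<notin> \<F>} \<in> events" using \<open>\<F> \<in> sets P\<close> by auto
  ultimately have "\<P>(F in P. expected_loss H x F \<ge> t) \<le> 1 - \<delta>"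
    using feas by (meson finite_measure_mono order_trans)
  then have "VaR P \<delta> (expected_loss H x) \<le> t"
    unfolding VaR_def by (intro cInf_lower bdd_below_VaR_levels meas \<open>0 < \<delta>\<close>) auto
  with t show False by simp
qed

text \<open>Integrability makes each Bochner integral a true expectation instead of the default 0.
  Taking the infimum in \<open>ereal\<close> and equating it with a real expresses finiteness of the
  VaR optimum, while \<open>\<gamma>_DR\<close> may be infinite.\<close>

theorem mainTheorem2:
  fixes X :: "(real ^ 'n) set"
    and H :: "real ^ 'n \<Rightarrow> real ^ 's \<Rightarrow> real"
    and P :: "(real ^ 's) measure measure"
    and \<delta> \<gamma>_VaR :: real
    and x_VaR :: "real ^ 'n"
  assumes "prob_space P"
    and "space P \<subseteq> space (prob_algebra borel)"
    and "\<And>x F. x \<in> X \<Longrightarrow> F \<in> space P \<Longrightarrow> integrable F (H x)"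
    and "\<And>x. x \<in> X \<Longrightarrow> expected_loss H x \<in> borel_measurable P"
    and "0 < \<delta>" and "\<delta> < 1"
    and "is_arg_min (\<lambda>x. VaR P \<delta> (expected_loss H x)) (\<lambda>x. x \<in> X) x_VaR"
    and "ereal \<gamma>_VaR = (INF x\<in>X. ereal (VaR P \<delta> (expected_loss H x)))"
  shows "is_arg_min (\<lambda>(x, \<F>). worst_case_loss H x \<F>) (robust_feasible X P \<delta>)
           (x_VaR, {F \<in> space P. expected_loss H x_VaR F \<le> \<gamma>_VaR}) \<and>
    (\<forall>\<F>_DR x_DR \<gamma>_DR.
       \<F>_DR \<in> sets P \<and> \<P>(F in P. F \<notin> \<F>_DR) \<le> 1 - \<delta> \<and>
       is_arg_min (\<lambda>x. worst_case_loss H x \<F>_DR) (\<lambda>x. x \<in> X) x_DR \<and>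
       \<gamma>_DR = (INF x\<in>X. worst_case_loss H x \<F>_DR)
       \<longrightarrow> robust_feasible X P \<delta> (x_DR, \<F>_DR) \<and> ereal \<gamma>_VaR \<le> \<gamma>_DR)"
proof -
  interpret prob_space P by fact
  let ?F = "{F \<in> space P. expected_loss H x_VaR F \<le> \<gamma>_VaR}"
  have xX: "x_VaR \<in> X" using assms(7) by (simp add: is_arg_min_def)
  have [measurable]: "expected_loss H x_VaR \<in> borel_measurable P" using assms(4)[OF xX] .
  have "ereal (VaR P \<delta> (expected_loss H x_VaR)) \<le> ereal \<gamma>_VaR"
    unfolding assms(8) using assms(7)
    by (intro INF_greatest) (auto simp: is_arg_min_def not_less)
  then have "VaR P \<delta> (expected_loss H x_VaR) \<le> \<gamma>_VaR" by simp
  then have "\<P>(F in P. expected_loss H x_VaR F > \<gamma>_VaR) \<le> 1 - \<delta>"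
    using \<open>\<delta> < 1\<close> by (intro prob_greater_VaR_le) auto
  moreover have "{F \<in> space P. F \<notin> ?F} = {F \<in> space P. expected_loss H x_VaR F > \<gamma>_VaR}"
    by auto
  ultimately have "robust_feasible X P \<delta> (x_VaR, ?F)"
    using xX by (simp add: robust_feasible_def)
  moreover have upper: "worst_case_loss H x_VaR ?F \<le> ereal \<gamma>_VaR"
    unfolding worst_case_loss_def by (intro SUP_least) auto
  \<comment> \<open>This bound over all feasible pairs serves twice: for optimality of the sublevel
    set and, with \<open>\<F>\<close> fixed, for the comparison with the distributionally robust
    optimum.\<close>
  have lower: "ereal \<gamma>_VaR \<le> worst_case_loss H x \<F>"
    if "x \<in> X" "\<F> \<in> sets P" "\<P>(F in P. F \<notin> \<F>) \<le> 1 - \<delta>" for x \<F>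
  proof -
    have "ereal \<gamma>_VaR \<le> ereal (VaR P \<delta> (expected_loss H x))"
      unfolding assms(8) using that(1) by (rule INF_lower)
    also have "\<dots> \<le> worst_case_loss H x \<F>"
      using VaR_le_worst_case_loss[OF assms(1) assms(4) \<open>0 < \<delta>\<close>] that by blast
    finally show ?thesis .
  qed
  ultimately have "is_arg_min (\<lambda>(x, \<F>). worst_case_loss H x \<F>) (robust_feasible X P \<delta>) (x_VaR, ?F)"
    \<comment> \<open>\<open>is_arg_min\<close> asks that no feasible pair be strictly better, so
      chaining the two bounds through \<open>\<gamma>_VaR\<close> suffices.\<close>
    using order_trans[OF upper lower]
    by (fastforce simp: is_arg_min_def robust_feasible_def not_less)
  moreover have "robust_feasible X P \<delta> (x_DR, \<F>_DR) \<and>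
      ereal \<gamma>_VaR \<le> (INF x\<in>X. worst_case_loss H x \<F>_DR)"
    if "\<F>_DR \<in> sets P" "\<P>(F in P. F \<notin> \<F>_DR) \<le> 1 - \<delta>"
      "is_arg_min (\<lambda>x. worst_case_loss H x \<F>_DR) (\<lambda>x. x \<in> X) x_DR" for \<F>_DR x_DR
    using that by (auto simp: robust_feasible_def is_arg_min_def intro!: INF_greatest lower)
  ultimately show ?thesis by blast
qed

end
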